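(* Suppose that $E_\kappa$ has an attracting periodic orbit of period $n>1$, and let $E_{\kappa'}$ be an exponential map with an attracting fixed point of the same multiplier as the attracting cycle of $E_\kappa$. Let $U$ be an immediate attracting basin of $E_\kappa$ (a Fatou component containing a point of the attracting cycle), and let $\Psi:U\to F(E_{\kappa'})$ be the conformal conjugacy between $E_\kappa^n|_U$ and $E_{\kappa'}|_{F(E_{\kappa'})}$, i.e. the conformal isomorphism with $\Psi\circ E_\kappa^n=E_{\kappa'}\circ\Psi$ on $U$. Then $\Psi$ does not extend continuously to $\partial U$; that is, there is no continuous map $\overline{U}\to\mathbb{C}$ (closure in $\mathbb{C}$) whose restriction to $U$ is $\Psi$.
   Context: For $\kappa\in\mathbb{C}$, $E_\kappa(z)=\exp(z)+\kappa$, and $F(E_\kappa)$ denotes its Fatou set. It is known that a conformal conjugacy $\Psi$ as in the claim exists. *)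

theory Defs
  imports "HOL-Complex_Analysis.Complex_Analysis"
begin

definition exp_map :: "complex \<Rightarrow> complex \<Rightarrow> complex" where
  "exp_map \<kappa> z = exp z + \<kappa>"

(* Normality in the sense of Montel, with the constant function infinity admitted as a limit.
   For holomorphic functions on a connected open set U this is normality with respect to the
   spherical metric: by Hurwitz, a spherical limit that takes the value infinity is constant. *)
definition normal_family_on :: "(complex \<Rightarrow> complex) set \<Rightarrow> complex set \<Rightarrow> bool" where
  "normal_family_on \<F> U \<longleftrightarrow>
     (\<forall>g :: nat \<Rightarrow> complex \<Rightarrow> complex. range g \<subseteq> \<F> \<longrightarrow>
       (\<exists>r :: nat \<Rightarrow> nat. strict_mono r \<and>
         ((\<exists>h. \<forall>K. compact K \<and> K \<subseteq> U \<longrightarrow> uniform_limit K (\<lambda>k. g (r k)) h sequentially) \<or>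
          (\<forall>K. compact K \<and> K \<subseteq> U \<longrightarrow>
             (\<forall>B::real. \<forall>\<^sub>F k in sequentially. \<forall>z\<in>K. norm (g (r k) z) > B)))))"

(* Neighbourhoods are connected because of the form of normal_family_on. *)
definition fatou_set :: "(complex \<Rightarrow> complex) \<Rightarrow> complex set" where
  "fatou_set f =
     {z. \<exists>U. open U \<and> connected U \<and> z \<in> U \<and> normal_family_on (range (\<lambda>n. f ^^ n)) U}"

(* The period n is the exact (minimal) one. *)
definition periodic_point :: "(complex \<Rightarrow> complex) \<Rightarrow> nat \<Rightarrow> complex \<Rightarrow> bool" where
  "periodic_point f n p \<longleftrightarrow>
     n > 0 \<and> (f ^^ n) p = p \<and> (\<forall>k. 0 < k \<and> k < n \<longrightarrow> (f ^^ k) p \<noteq> p)"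

definition multiplier :: "(complex \<Rightarrow> complex) \<Rightarrow> nat \<Rightarrow> complex \<Rightarrow> complex" where
  "multiplier f n p = deriv (f ^^ n) p"

definition attracting_periodic_point :: "(complex \<Rightarrow> complex) \<Rightarrow> nat \<Rightarrow> complex \<Rightarrow> bool" where
  "attracting_periodic_point f n p \<longleftrightarrow> periodic_point f n p \<and> norm (multiplier f n p) < 1"

(* p is any point of the attracting cycle; U contains some, possibly different, point of it. *)
definition immediate_basin :: "(complex \<Rightarrow> complex) \<Rightarrow> complex \<Rightarrow> complex set \<Rightarrow> bool" where
  "immediate_basin f p U \<longleftrightarrow> U \<in> components (fatou_set f) \<and> (\<exists>j. (f ^^ j) p \<in> U)"

(* For open U the inverse of a holomorphic bijection is automatically holomorphic. *)
definition conformal_isomorphism ::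
  "(complex \<Rightarrow> complex) \<Rightarrow> complex set \<Rightarrow> complex set \<Rightarrow> bool" where
  "conformal_isomorphism \<Psi> U V \<longleftrightarrow> \<Psi> holomorphic_on U \<and> bij_betw \<Psi> U V"

end

theory Submission
  imports Defs
begin

text \<open>
  Suppose that \<open>\<Psi>\<close> extends continuously to the closure of \<open>U\<close>. Then \<open>\<Psi>\<close> is bounded on bounded parts of
  \<open>U\<close>, and the conjugacy bounds \<open>\<Psi>\<close> at \<open>E\<^sup>m\<^sup>n z\<close> by an \<open>m\<close>-fold iterated exponential, uniformly for \<open>z\<close> in a
  bounded part of \<open>U\<close>.

  Let \<open>U\<^sub>0\<close> be the component of the cycle whose successor contains the asymptotic value \<open>\<kappa>\<close>; it contains a
  left half plane and is invariant under translation by \<open>2 \<pi> i\<close>. (That \<open>\<kappa>\<close> lies in the cycle of components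
  follows from Bloch's theorem: otherwise all inverse branches of \<open>E\<^sup>n\<close> along the cycle exist on a fixed
  disc, their derivatives are unbounded, and some image contains two points that differ by \<open>2 \<pi> i\<close>, where
  \<open>E\<close> is not injective.)
  If \<open>G\<close> denotes the inverse branch from \<open>U\<^sub>0\<close> to \<open>U\<close> along the cycle, then \<open>\<Psi> \<circ> G\<close> is injective and
  takes values that differ by multiples of \<open>2 \<pi> i\<close> on \<open>h + 2 \<pi> i \<int>\<close>, so among its values at the
  first \<open>j\<close> of these points one has size at least proportional to \<open>j\<close>. On the other hand, since only the branch into \<open>U\<^sub>0\<close> is
  ambiguous, every point of \<open>U\<^sub>0\<close> of size \<open>r\<close> that is linked suitably to the half plane has an
  \<open>E\<^sup>n\<close>-preimage in \<open>U\<^sub>0\<close> of size \<open>O(log log r)\<close>, because \<open>n \<ge> 2\<close>. Hence \<open>m\<close> pullbacks bring points whose size is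
  a \<open>2m\<close>-fold iterated exponential back to a bounded set, which contradicts the bound on \<open>\<Psi>\<close>.
\<close>

section \<open>Elementary facts about the exponential map\<close>

lemma exp_map_add_period [simp]: "exp_map \<kappa> (z + of_int k * (2 * of_real pi * \<i>)) = exp_map \<kappa> z"
proof -
  have "exp (z + of_int k * (2 * of_real pi * \<i>)) = exp z"
    by (subst exp_eq) (auto intro!: exI[of _ k] simp: algebra_simps)
  then show ?thesis by (simp add: exp_map_def)
qed

lemma exp_map_eqE:
  assumes "exp_map \<kappa> a = exp_map \<kappa> b"
  obtains k :: int where "a = b + of_int k * (2 * of_real pi * \<i>)"
proof -
  have "exp a = exp b" using assms by (simp add: exp_map_def)
  then obtain k :: int where "a = b + (of_int (2 * k) * of_real pi) * \<i>"
    unfolding exp_eq by auto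
  then show ?thesis using that[of k] by (simp add: algebra_simps)
qed

lemma exp_map_holomorphic: "exp_map \<kappa> holomorphic_on S"
  unfolding exp_map_def by (intro holomorphic_intros)

lemma exp_map_funpow_holomorphic: "(exp_map \<kappa> ^^ k) holomorphic_on S"
proof (induction k arbitrary: S)
  case 0
  then show ?case by (simp add: id_def)
next
  case (Suc k)
  show ?case
    using holomorphic_on_compose[OF Suc.IH[of S] exp_map_holomorphic] by (simp add: o_def)
qed

lemma norm_exp_map_le: "norm (exp_map \<kappa> z) \<le> exp (norm z) + norm \<kappa>"
proof -
  have "norm (exp_map \<kappa> z) \<le> norm (exp z) + norm \<kappa>"
    unfolding exp_map_def by (rule norm_triangle_ineq)
  also have "norm (exp z) \<le> exp (norm z)"
    by (rule norm_exp)
  finally show ?thesis by simp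
qed

section \<open>Invariance of the Fatou set\<close>

lemma open_fatou_set: "open (fatou_set f)"
proof (rule openI)
  fix z assume "z \<in> fatou_set f"
  then obtain U where "open U" "connected U" "z \<in> U" "normal_family_on (range (\<lambda>n. f ^^ n)) U"
    unfolding fatou_set_def by auto
  then have "open U \<and> z \<in> U \<and> U \<subseteq> fatou_set f"
    unfolding fatou_set_def by auto
  then show "\<exists>e>0. ball z e \<subseteq> fatou_set f"
    by (meson open_contains_ball subset_trans)
qed

lemma funpow_in_range: "range g \<subseteq> range (\<lambda>n::nat. f ^^ n) \<Longrightarrow> \<exists>m. \<forall>k. g k = f ^^ m k"
  by (intro choice) auto

text \<open>Precomposition with \<phi> turns subsequential limits on \<open>V\<close> into limits on
  \<open>U\<close>, because \<phi> maps compact sets to compact sets. The identity need not factor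
  through \<phi>, so \<open>m = 0\<close> is excluded from \<open>semi\<close>; a sequence
  containing the identity infinitely often has a constant subsequence. Applied below with \<phi> the
  map itself and with \<phi> a translation by a period.\<close>

lemma normal_family_on_semiconjugate:
  assumes \<phi>: "continuous_on U \<phi>" "\<phi> ` U \<subseteq> V"
    and V: "normal_family_on (range (\<lambda>n. f ^^ n)) V"
    and semi: "\<And>m. m \<noteq> 0 \<Longrightarrow> \<exists>m'. \<forall>z. (f ^^ m) z = (f ^^ m') (\<phi> z)"
  shows "normal_family_on (range (\<lambda>n. f ^^ n)) U"
  unfolding normal_family_on_def
proof (intro allI impI)
  fix g :: "nat \<Rightarrow> complex \<Rightarrow> complex" assume "range g \<subseteq> range (\<lambda>n. f ^^ n)"
  then obtain m where m: "\<And>k. g k = f ^^ m k" using funpow_in_range by metis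
  let ?P = "\<lambda>r::nat \<Rightarrow> nat. (\<exists>h. \<forall>K. compact K \<and> K \<subseteq> U \<longrightarrow> uniform_limit K (\<lambda>k. g (r k)) h sequentially) \<or>
          (\<forall>K. compact K \<and> K \<subseteq> U \<longrightarrow> (\<forall>B::real. \<forall>\<^sub>F k in sequentially. \<forall>z\<in>K. norm (g (r k) z) > B))"
  show "\<exists>r::nat \<Rightarrow> nat. strict_mono r \<and> ?P r"
  proof (cases "infinite {k. m k = 0}")
    case True
    define r where "r = enumerate {k. m k = 0}"
    have r: "strict_mono r" unfolding r_def using True by (rule strict_mono_enumerate)
    have "m (r k) = 0" for k using enumerate_in_set[OF True, of k] by (simp add: r_def)
    then have "g (r k) = id" for k by (simp add: m)
    then have "?P r" by (auto intro!: exI[of _ id] uniform_limit_const)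
    with r show ?thesis by blast
  next
    case False
    then have "infinite {k. m k \<noteq> 0}"
      by (metis (mono_tags, lifting) Collect_cong finite_Collect_not infinite_UNIV_nat)
    note inf = this
    define r where "r = enumerate {k. m k \<noteq> 0}"
    have r: "strict_mono r" unfolding r_def using inf by (rule strict_mono_enumerate)
    have mr: "m (r k) \<noteq> 0" for k using enumerate_in_set[OF inf, of k] by (simp add: r_def)
    obtain m' where m': "\<And>k z. (f ^^ m (r k)) z = (f ^^ m' k) (\<phi> z)"
      using semi[OF mr] by metis
    define g' where "g' k = f ^^ m' k" for k
    have gg': "g (r k) z = g' k (\<phi> z)" for k z
      by (simp add: m m' g'_def)
    have "range g' \<subseteq> range (\<lambda>n. f ^^ n)" by (auto simp: g'_def)
    from V[unfolded normal_family_on_def, rule_format, OF this]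
    obtain s :: "nat \<Rightarrow> nat" where s: "strict_mono s" and lim:
      "(\<exists>h. \<forall>K. compact K \<and> K \<subseteq> V \<longrightarrow> uniform_limit K (\<lambda>k. g' (s k)) h sequentially) \<or>
          (\<forall>K. compact K \<and> K \<subseteq> V \<longrightarrow> (\<forall>B::real. \<forall>\<^sub>F k in sequentially. \<forall>z\<in>K. norm (g' (s k) z) > B))"
      by blast
    have K: "compact (\<phi> ` K) \<and> \<phi> ` K \<subseteq> V" if "compact K \<and> K \<subseteq> U" for K
      using that \<phi>(2) compact_continuous_image continuous_on_subset[OF \<phi>(1)] by blast
    have "?P (r \<circ> s)"
      using lim
    proof (elim disjE exE)
      fix h assume h: "\<forall>K. compact K \<and> K \<subseteq> V \<longrightarrow> uniform_limit K (\<lambda>k. g' (s k)) h sequentially"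
      have "uniform_limit K (\<lambda>k. g ((r \<circ> s) k)) (h \<circ> \<phi>) sequentially" if "compact K \<and> K \<subseteq> U" for K
        using h[rule_format, OF K[OF that]] unfolding uniform_limit_iff by (simp add: gg')
      then show ?thesis by blast
    next
      assume h: "\<forall>K. compact K \<and> K \<subseteq> V \<longrightarrow> (\<forall>B::real. \<forall>\<^sub>F k in sequentially. \<forall>z\<in>K. norm (g' (s k) z) > B)"
      have "\<forall>\<^sub>F k in sequentially. \<forall>z\<in>K. norm (g ((r \<circ> s) k) z) > B" if "compact K \<and> K \<subseteq> U" for K and B :: real
        using h[rule_format, OF K[OF that], of B] by (simp add: gg')
      then show ?thesis by blast
    qed
    moreover have "strict_mono (r \<circ> s)" using r s by (simp add: strict_mono_o)
    ultimately show ?thesis by blast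
  qed
qed

lemma fatou_set_semiconjugate:
  assumes \<phi>: "continuous_on UNIV \<phi>" and "\<phi> z \<in> fatou_set f"
    and semi: "\<And>m. m \<noteq> 0 \<Longrightarrow> \<exists>m'. \<forall>z. (f ^^ m) z = (f ^^ m') (\<phi> z)"
  shows "z \<in> fatou_set f"
proof -
  obtain V where V: "open V" "\<phi> z \<in> V" "normal_family_on (range (\<lambda>n. f ^^ n)) V"
    using assms(2) unfolding fatou_set_def by auto
  have "open (\<phi> -` V)" using \<phi> V(1) by (simp add: open_vimage continuous_on_eq_continuous_at)
  with V(2) obtain e where e: "e > 0" "ball z e \<subseteq> \<phi> -` V"
    by (meson open_contains_ball vimageI)
  have "continuous_on (ball z e) \<phi>" using \<phi> continuous_on_subset by blast
  then have "normal_family_on (range (\<lambda>n. f ^^ n)) (ball z e)"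
    using e by (intro normal_family_on_semiconjugate[OF _ _ V(3) semi]) auto
  with e show ?thesis unfolding fatou_set_def
    by (auto intro!: exI[of _ "ball z e"])
qed

section \<open>The asymptotic value lies in the basin\<close>

text \<open>Everything used below about the Fatou set of \<open>exp_map \<kappa>\<close> follows
  from these three properties.\<close>

locale exp_backward_invariant =
  fixes \<kappa> :: complex and F :: "complex set"
  assumes open_F: "open F"
    and backward: "exp_map \<kappa> z \<in> F \<Longrightarrow> z \<in> F"
    and translate: "z \<in> F \<Longrightarrow> z + of_int j * (2 * of_real pi * \<i>) \<in> F"

lemma exp_backward_invariant_fatou_set:
  "exp_backward_invariant \<kappa> (fatou_set (exp_map \<kappa>))"
proof
  show "open (fatou_set (exp_map \<kappa>))" by (rule open_fatou_set)
next
  fix z assume z: "exp_map \<kappa> z \<in> fatou_set (exp_map \<kappa>)"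
  have semi: "\<exists>m'. \<forall>z. (exp_map \<kappa> ^^ m) z = (exp_map \<kappa> ^^ m') (exp_map \<kappa> z)" if "m \<noteq> 0" for m
    using that by (cases m) (auto simp del: funpow.simps simp: funpow_Suc_right)
  show "z \<in> fatou_set (exp_map \<kappa>)"
    by (rule fatou_set_semiconjugate[OF holomorphic_on_imp_continuous_on[OF exp_map_holomorphic] z semi])
next
  fix z j assume z: "z \<in> fatou_set (exp_map \<kappa>)"
  let ?\<phi> = "\<lambda>z. z + of_int (- j) * (2 * of_real pi * \<i>)"
  have semi: "\<exists>m'. \<forall>z. (exp_map \<kappa> ^^ m) z = (exp_map \<kappa> ^^ m') (?\<phi> z)" if m: "m \<noteq> 0" for m
  proof (intro exI allI)
    fix z
    obtain l where "m = Suc l" using m not0_implies_Suc by blast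
    then show "(exp_map \<kappa> ^^ m) z = (exp_map \<kappa> ^^ m) (?\<phi> z)"
      by (simp only: funpow_Suc_right o_apply exp_map_add_period)
  qed
  have z': "?\<phi> (z + of_int j * (2 * of_real pi * \<i>)) \<in> fatou_set (exp_map \<kappa>)"
    using z by simp
  have cont: "continuous_on UNIV ?\<phi>" by (intro continuous_intros)
  show "z + of_int j * (2 * of_real pi * \<i>) \<in> fatou_set (exp_map \<kappa>)"
    by (rule fatou_set_semiconjugate[OF cont z' semi])
qed

context exp_backward_invariant
begin

lemma funpow_backward: "(exp_map \<kappa> ^^ k) z \<in> F \<Longrightarrow> z \<in> F"
proof (induction k)
  case (Suc k)
  then show ?case using backward[of "(exp_map \<kappa> ^^ k) z"] by simp
qed simp

text \<open>Path lifting for the covering \<open>exp_map \<kappa>\<close> of the plane without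
  \<kappa>. An open connected set stays path connected when \<kappa> is removed, and the lifted path
  stays in \<open>F\<close> by backward invariance.\<close>

lemma connected_component_lift:
  assumes "connected_component F (exp_map \<kappa> a) c" "c \<noteq> \<kappa>"
  obtains a' where "connected_component F a a'" "exp_map \<kappa> a' = c"
proof -
  let ?C = "connected_component_set F (exp_map \<kappa> a)"
  have a: "exp_map \<kappa> a \<in> F" using connected_component_in[OF assms(1)] by blast
  have "open ?C" using open_F by (rule open_connected_component)
  then have "path_connected (?C - {\<kappa>})"
    by (intro path_connected_open_delete) auto
  moreover have "exp_map \<kappa> a \<in> ?C - {\<kappa>}" "c \<in> ?C - {\<kappa>}"
    using a assms by (auto simp: exp_map_def)
  ultimately obtain \<gamma> where \<gamma>: "path \<gamma>" "path_image \<gamma> \<subseteq> ?C - {\<kappa>}"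
      "pathstart \<gamma> = exp_map \<kappa> a" "pathfinish \<gamma> = c"
    unfolding path_connected_def by blast
  have cont: "continuous_on {0..1} (\<lambda>t. \<gamma> t - \<kappa>)"
    using \<gamma>(1) unfolding path_def by (intro continuous_intros)
  have \<gamma>_in: "\<gamma> t \<in> ?C - {\<kappa>}" if "t \<in> {0..1}" for t
    using \<gamma>(2) that unfolding path_image_def by blast
  obtain g where g: "continuous_on {0..1} g" "\<And>t. t \<in> {0..1} \<Longrightarrow> \<gamma> t - \<kappa> = exp (g t)"
    using continuous_logarithm_on_contractible[OF cont] \<gamma>_in
    by (metis DiffD2 convex_imp_contractible convex_real_interval(5) eq_iff_diff_eq_0 singletonI)
  have "exp_map \<kappa> (g 0) = exp_map \<kappa> a"
    using g(2)[of 0] \<gamma>(3) by (simp add: exp_map_def pathstart_def algebra_simps)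
  then obtain k :: int where k: "g 0 = a + of_int k * (2 * of_real pi * \<i>)"
    by (rule exp_map_eqE)
  \<comment> \<open>The logarithm may start at another preimage of
    \<open>exp_map \<kappa> a\<close>; the shift by a period makes the lift start at
    \<open>a\<close>.\<close>
  define h where "h t = g t + of_int (-k) * (2 * of_real pi * \<i>)" for t
  have h0: "h 0 = a" by (simp add: h_def k)
  have Eh: "exp_map \<kappa> (h t) = \<gamma> t" if "t \<in> {0..1}" for t
    unfolding h_def exp_map_add_period using g(2)[OF that] by (simp add: exp_map_def algebra_simps)
  have conn: "connected (h ` {0..1})"
    unfolding h_def by (intro connected_continuous_image continuous_intros g(1)) auto
  have sub: "h ` {0..1} \<subseteq> F"
  proof clarify
    fix t :: real assume t: "t \<in> {0..1}"
    have "\<gamma> t \<in> F" using \<gamma>_in[OF t] connected_component_subset by blast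
    then show "h t \<in> F" using backward[of "h t"] Eh[OF t] by simp
  qed
  have "a \<in> h ` {0..1}" "h 1 \<in> h ` {0..1}" using h0 by (auto intro: rev_image_eqI)
  then have "connected_component F a (h 1)"
    unfolding connected_component_def using conn sub by blast
  moreover have "exp_map \<kappa> (h 1) = c" using Eh[of 1] \<gamma>(4) by (simp add: pathfinish_def)
  ultimately show ?thesis by (rule that)
qed

text \<open>Used for inverse branches \<open>g\<close> of an iterate: backward invariance puts their
  connected image into \<open>F\<close>, hence into a single component.\<close>

lemma connected_component_image:
  assumes "connected T" "continuous_on T g" "\<And>z. z \<in> T \<Longrightarrow> (exp_map \<kappa> ^^ k) (g z) \<in> F"
    "x \<in> T" "y \<in> T"
  shows "connected_component F (g x) (g y)"
proof -
  have "connected (g ` T)" "g ` T \<subseteq> F"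
    using assms(1-3) funpow_backward by (blast intro: connected_continuous_image)+
  then show ?thesis using assms(4,5) unfolding connected_component_def by blast
qed

lemma asymptotic_value_in_basin:
  assumes n: "n > 0" and per: "(exp_map \<kappa> ^^ n) p = p" and att: "norm (multiplier (exp_map \<kappa>) n p) < 1"
    and "p \<in> F"
  obtains i where "connected_component F ((exp_map \<kappa> ^^ i) p) \<kappa>"
proof (rule ccontr)
  assume "\<not> thesis"
  with that have no: "\<not> connected_component F ((exp_map \<kappa> ^^ i) p) \<kappa>" for i by blast
  let ?E = "exp_map \<kappa>"
  obtain r where r: "r > 0" "ball p r \<subseteq> F" using \<open>p \<in> F\<close> open_F open_contains_ball by blast
  have per': "(?E ^^ (j + n)) p = (?E ^^ j) p" for j
    by (simp add: funpow_add per)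
  \<comment> \<open>Since \<open>n - 1\<close> is -1 modulo \<open>n\<close>, the point prescribed
    for \<open>g p\<close> is the \<open>k\<close>-th preimage of \<open>p\<close> on its cycle. The
    image of \<open>g\<close> lies in the component of that point, hence omits \<kappa> by
    \<open>no\<close>, and a further logarithm can be taken.\<close>
  have inverse_branch: "\<exists>g. g holomorphic_on ball p r \<and> (\<forall>z\<in>ball p r. (?E ^^ k) (g z) = z) \<and>
      g p = (?E ^^ (k * (n - 1))) p" for k
  proof (induction k)
    case 0
    show ?case by (auto intro!: exI[of _ "\<lambda>z. z"])
  next
    case (Suc k)
    then obtain g where g: "g holomorphic_on ball p r" "\<And>z. z \<in> ball p r \<Longrightarrow> (?E ^^ k) (g z) = z"
       "g p = (?E ^^ (k * (n - 1))) p" by blast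
    have "connected_component F (g p) (g z)" if "z \<in> ball p r" for z
      using g(2) r that
      by (intro connected_component_image[where T = "ball p r" and k = k]
          holomorphic_on_imp_continuous_on g(1)) auto
    then have "g z - \<kappa> \<noteq> 0" if "z \<in> ball p r" for z
      using no g(3) that by (metis eq_iff_diff_eq_0)
    moreover have "(\<lambda>z. g z - \<kappa>) holomorphic_on ball p r" by (intro holomorphic_intros g)
    ultimately obtain h where h: "h holomorphic_on ball p r" "\<And>z. z \<in> ball p r \<Longrightarrow> g z - \<kappa> = exp (h z)"
      using contractible_imp_holomorphic_log[OF _ convex_imp_contractible[OF convex_ball]] by blast
    have hg: "?E (h z) = g z" if "z \<in> ball p r" for z
      using h(2)[OF that] by (simp add: exp_map_def algebra_simps)
    have "?E ((?E ^^ (Suc k * (n - 1))) p) = (?E ^^ (k * (n - 1) + n)) p"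
      using n by (cases n) (simp_all add: algebra_simps)
    also have "\<dots> = ?E (h p)" using per' g(3) hg r by simp
    finally obtain j :: int where j: "(?E ^^ (Suc k * (n - 1))) p = h p + of_int j * (2 * of_real pi * \<i>)"
      by (rule exp_map_eqE)
    let ?g = "\<lambda>z. h z + of_int j * (2 * of_real pi * \<i>)"
    have "?g holomorphic_on ball p r" by (intro holomorphic_intros h)
    moreover have "(?E ^^ Suc k) (?g z) = z" if "z \<in> ball p r" for z
      using hg[OF that] g(2)[OF that] by (simp only: funpow_Suc_right o_apply exp_map_add_period)
    ultimately show ?case using j by (intro exI[of _ ?g]) auto
  qed
  define \<mu> where "\<mu> = multiplier ?E n p"
  have DE: "((?E ^^ n) has_field_derivative \<mu>) (at p)"
    unfolding \<mu>_def multiplier_def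
    by (rule holomorphic_derivI[OF exp_map_funpow_holomorphic open_UNIV]) simp
  have DEl: "((?E ^^ (n * l)) has_field_derivative \<mu> ^ l) (at p) \<and> (?E ^^ (n * l)) p = p" for l
  proof (induction l)
    case 0
    show ?case by (auto simp: id_def)
  next
    case (Suc l)
    then have "((?E ^^ n) \<circ> (?E ^^ (n * l)) has_field_derivative \<mu> * \<mu> ^ l) (at p)"
      using DE by (intro DERIV_chain) auto
    then show ?case using Suc per by (simp add: funpow_add algebra_simps o_def)
  qed
  \<comment> \<open>The inverse branch has derivative of size \<open>1 / norm \<mu> ^ l\<close> at
    \<open>p\<close>. As 84 = 7 * 12, Bloch's theorem with constant 1/12 yields a disc of radius 7 >
    2 pi in its image. The bound by 1 rules out \<open>l = 0\<close>.\<close>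
  obtain l where l: "norm \<mu> ^ l < min (r / 84) 1"
    using real_arch_pow_inv[of "min (r / 84) 1" "norm \<mu>"] att r(1) unfolding \<mu>_def[symmetric] by auto
  have "l \<noteq> 0" using l by (intro notI) simp
  obtain g where g: "g holomorphic_on ball p r" "\<And>z. z \<in> ball p r \<Longrightarrow> (?E ^^ (n * l)) (g z) = z"
    "g p = (?E ^^ (n * l * (n - 1))) p"
    using inverse_branch by blast
  have gp: "g p = p" using g(3) DEl[of "l * (n - 1)"] by (simp add: mult.assoc)
  have "(g has_field_derivative deriv g p) (at p)"
    by (rule holomorphic_derivI[OF g(1)]) (use r in auto)
  then have "((?E ^^ (n * l)) \<circ> g has_field_derivative \<mu> ^ l * deriv g p) (at p)"
    using DEl[of l] gp by (intro DERIV_chain) auto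
  then have "((\<lambda>z. z) has_field_derivative \<mu> ^ l * deriv g p) (at p)"
    using g(2) r by (elim has_field_derivative_transform_within_open[where S = "ball p r"]) auto
  then have "\<mu> ^ l * deriv g p = 1" using DERIV_ident DERIV_unique by blast
  then have 1: "norm \<mu> ^ l * norm (deriv g p) = 1" by (metis norm_mult norm_one norm_power)
  have "norm \<mu> ^ l * norm (deriv g p) \<le> r / 84 * norm (deriv g p)"
    using l by (intro mult_right_mono) auto
  then have "7 \<le> r * norm (deriv g p) / 12" using 1 by simp
  from Bloch[OF g(1) r(1) this] obtain b where b: "ball b 7 \<subseteq> g ` ball p r" .
  have "norm (2 * of_real pi * \<i>) = 2 * pi" by (simp add: norm_mult)
  then have "b \<in> ball b 7" "b + of_int 1 * (2 * of_real pi * \<i>) \<in> ball b 7"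
    using pi_less_4 pi_approx by (auto simp: dist_norm)
  then obtain x y where xy: "x \<in> ball p r" "y \<in> ball p r" "b = g x" "b + of_int 1 * (2 * of_real pi * \<i>) = g y"
    using b by (meson imageE subsetD)
  obtain k where k: "n * l = Suc k" using n \<open>l \<noteq> 0\<close> not0_implies_Suc by fastforce
  have "x = (?E ^^ (n * l)) b" using g(2) xy by simp
  also have "\<dots> = (?E ^^ (n * l)) (b + of_int 1 * (2 * of_real pi * \<i>))"
    unfolding k by (simp only: funpow_Suc_right o_apply exp_map_add_period)
  also have "\<dots> = y" using g(2) xy by simp
  finally show False using xy by simp
qed

end

section \<open>Inverse branches on a half plane\<close>

text \<open>
  Above height \<^term>\<open>height (norm \<kappa>) n\<close>, taking \<open>n\<close> logarithms of \<open>z - \<kappa>\<close> in succession never meets the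
  cut of \<^const>\<open>Ln\<close>: after the first one all values have real part larger than \<^term>\<open>norm \<kappa>\<close>.
\<close>

primrec height :: "real \<Rightarrow> nat \<Rightarrow> real" where
  "height c 0 = c + 2"
| "height c (Suc m) = exp (height c m) + c"

lemma height_ge: "c \<ge> 0 \<Longrightarrow> height c m \<ge> c + 2"
proof (induction m)
  case (Suc m)
  then show ?case using exp_ge_add_one_self[of "height c m"]
    unfolding height.simps by linarith
qed simp

text \<open>The integer \<open>k i\<close> selects the branch of the logarithm at step
  \<open>i\<close>; it will be chosen so that a base point follows the cycle of components
  backwards.\<close>

primrec inv_branch :: "complex \<Rightarrow> (nat \<Rightarrow> int) \<Rightarrow> nat \<Rightarrow> complex \<Rightarrow> complex" where
  "inv_branch \<kappa> k 0 z = z"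
| "inv_branch \<kappa> k (Suc i) z = Ln (inv_branch \<kappa> k i z - \<kappa>) + of_int (k i) * (2 * of_real pi * \<i>)"

lemma inv_branch_cong: "(\<And>j. j < i \<Longrightarrow> k j = k' j) \<Longrightarrow> inv_branch \<kappa> k i z = inv_branch \<kappa> k' i z"
  by (induction i) auto

text \<open>The starting point is far up, which gives a positive imaginary part. After each
  logarithm the real part is \<open>ln\<close> of the previous distance to \<kappa>, so the lower
  bound descends by exactly one stage of \<open>height\<close>.\<close>

lemma inv_branch_far:
  assumes "Im z \<ge> height (norm \<kappa>) n" "i \<le> n"
  shows "(0 < Im (inv_branch \<kappa> k i z - \<kappa>) \<or> 0 < Re (inv_branch \<kappa> k i z - \<kappa>)) \<and>
    norm (inv_branch \<kappa> k i z - \<kappa>) \<ge> height (norm \<kappa>) (n - i) - norm \<kappa>"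
  using assms(2)
proof (induction i)
  case 0
  have "Im z - Im \<kappa> \<ge> height (norm \<kappa>) n - norm \<kappa>"
    using assms(1) abs_Im_le_cmod[of \<kappa>] by simp
  moreover have "norm (z - \<kappa>) \<ge> Im z - Im \<kappa>"
    using abs_Im_le_cmod[of "z - \<kappa>"] by simp
  ultimately show ?case using height_ge[of "norm \<kappa>" n] by auto
next
  case (Suc i)
  let ?w = "inv_branch \<kappa> k i z - \<kappa>"
  have "n - i = Suc (n - Suc i)" using Suc.prems by simp
  then have w: "norm ?w \<ge> exp (height (norm \<kappa>) (n - Suc i))" using Suc by simp
  then have nz: "?w \<noteq> 0" by (metis exp_gt_zero norm_zero not_le)
  have "Re (inv_branch \<kappa> k (Suc i) z) = ln (norm ?w)" using nz by simp
  also have "\<dots> \<ge> height (norm \<kappa>) (n - Suc i)" using w nz by (simp add: ln_ge_iff)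
  finally have "Re (inv_branch \<kappa> k (Suc i) z - \<kappa>) \<ge> height (norm \<kappa>) (n - Suc i) - norm \<kappa>"
    using abs_Re_le_cmod[of \<kappa>] by simp
  then show ?case
    using height_ge[of "norm \<kappa>" "n - Suc i"] abs_Re_le_cmod[of "inv_branch \<kappa> k (Suc i) z - \<kappa>"] by auto
qed

lemma inv_branch_norm_ge:
  assumes "Im z \<ge> height (norm \<kappa>) n" "i \<le> n"
  shows "norm (inv_branch \<kappa> k i z - \<kappa>) \<ge> 2"
  using inv_branch_far[OF assms, of k] height_ge[of "norm \<kappa>" "n - i"] by simp

lemma inv_branch_not_nonpos:
  assumes "Im z \<ge> height (norm \<kappa>) n" "i \<le> n"
  shows "inv_branch \<kappa> k i z - \<kappa> \<notin> \<real>\<^sub>\<le>\<^sub>0"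
  using inv_branch_far[OF assms, of k] by (auto simp: complex_nonpos_Reals_iff)

lemma inv_branch_continuous:
  assumes "i \<le> n"
  shows "continuous_on {z. Im z \<ge> height (norm \<kappa>) n} (inv_branch \<kappa> k i)"
  using assms
proof (induction i)
  case 0
  show ?case by (simp add: continuous_on_id)
next
  case (Suc i)
  then show ?case using inv_branch_not_nonpos
    by (auto intro!: continuous_intros)
qed

lemma exp_map_inv_branch:
  assumes "Im z \<ge> height (norm \<kappa>) n" "i \<le> n"
  shows "exp_map \<kappa> (inv_branch \<kappa> k (Suc i) z) = inv_branch \<kappa> k i z"
proof -
  have "inv_branch \<kappa> k i z - \<kappa> \<noteq> 0" using inv_branch_norm_ge[OF assms, of k] by auto
  then show ?thesis unfolding inv_branch.simps exp_map_add_period by (simp add: exp_map_def)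
qed

lemma exp_map_funpow_inv_branch:
  assumes "Im z \<ge> height (norm \<kappa>) n" "i + m \<le> n"
  shows "(exp_map \<kappa> ^^ m) (inv_branch \<kappa> k (i + m) z) = inv_branch \<kappa> k i z"
  using assms(2)
proof (induction m)
  case (Suc m)
  have "(exp_map \<kappa> ^^ Suc m) (inv_branch \<kappa> k (i + Suc m) z) =
      (exp_map \<kappa> ^^ m) (exp_map \<kappa> (inv_branch \<kappa> k (Suc (i + m)) z))"
    by (simp only: funpow_Suc_right o_apply add_Suc_right)
  also have "\<dots> = inv_branch \<kappa> k i z"
    using Suc by (subst exp_map_inv_branch[OF assms(1)]) auto
  finally show ?case .
qed simp

lemma norm_inv_branch_Suc:
  assumes "Im z \<ge> height (norm \<kappa>) n" "i < n" and K: "\<forall>j<n. pi + 2 * pi * \<bar>real_of_int (k j)\<bar> \<le> K"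
  shows "norm (inv_branch \<kappa> k (Suc i) z) \<le> ln (norm (inv_branch \<kappa> k i z) + norm \<kappa>) + K"
proof -
  let ?w = "inv_branch \<kappa> k i z - \<kappa>"
  have w: "norm ?w \<ge> 2" using inv_branch_norm_ge assms by simp
  then have nz: "?w \<noteq> 0" by auto
  have "norm (Ln ?w) \<le> \<bar>Re (Ln ?w)\<bar> + \<bar>Im (Ln ?w)\<bar>" by (rule cmod_le)
  also have "\<bar>Im (Ln ?w)\<bar> \<le> pi"
    using Im_Ln_le_pi[OF nz] mpi_less_Im_Ln[OF nz] by linarith
  also have "\<bar>Re (Ln ?w)\<bar> = ln (norm ?w)" using w nz by simp
  also have "ln (norm ?w) \<le> ln (norm (inv_branch \<kappa> k i z) + norm \<kappa>)"
    using w norm_triangle_ineq4[of "inv_branch \<kappa> k i z" \<kappa>] by (intro ln_mono) auto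
  finally have "norm (Ln ?w) \<le> ln (norm (inv_branch \<kappa> k i z) + norm \<kappa>) + pi" by simp
  moreover have "norm (inv_branch \<kappa> k (Suc i) z) \<le> norm (Ln ?w) + 2 * pi * \<bar>real_of_int (k i)\<bar>"
    using norm_triangle_ineq[of "Ln ?w" "of_int (k i) * (2 * of_real pi * \<i>)"]
    by (simp add: norm_mult mult_ac)
  ultimately show ?thesis using K assms(2) by (auto simp del: inv_branch.simps(2) dest!: spec[of _ i])
qed

lemma norm_inv_branch_Suc':
  assumes "Im z \<ge> height (norm \<kappa>) n" "i < n" and K: "\<forall>j<n. pi + 2 * pi * \<bar>real_of_int (k j)\<bar> \<le> K"
  shows "norm (inv_branch \<kappa> k (Suc i) z) \<le> norm (inv_branch \<kappa> k i z) + norm \<kappa> + K"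
proof -
  have "0 < norm (inv_branch \<kappa> k i z) + norm \<kappa>"
    using inv_branch_norm_ge[of \<kappa> n z i k] assms norm_triangle_ineq4[of "inv_branch \<kappa> k i z" \<kappa>] by simp
  then have "ln (norm (inv_branch \<kappa> k i z) + norm \<kappa>) \<le> norm (inv_branch \<kappa> k i z) + norm \<kappa>"
    using ln_bound by blast
  then show ?thesis using norm_inv_branch_Suc[OF assms] by (simp del: inv_branch.simps(2))
qed

lemma norm_inv_branch_le:
  assumes "Im z \<ge> height (norm \<kappa>) n" "i + m \<le> n" and K: "\<forall>j<n. pi + 2 * pi * \<bar>real_of_int (k j)\<bar> \<le> K"
  shows "norm (inv_branch \<kappa> k (i + m) z) \<le> norm (inv_branch \<kappa> k i z) + m * (norm \<kappa> + K)"
  using assms(2)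
proof (induction m)
  case (Suc m)
  then show ?case using norm_inv_branch_Suc'[OF assms(1) _ K, of "i + m"]
    by (simp add: algebra_simps del: inv_branch.simps(2))
qed simp

text \<open>The first and the last of the \<open>n\<close> steps each contribute a logarithm, which
  is where \<open>2 \<le> n\<close> enters; the \<open>n - 2\<close> steps between them are
  estimated crudely and cost only an additive constant.\<close>

lemma norm_inv_branch_loglog:
  assumes "2 \<le> n"
  obtains B where "B \<ge> 0"
    "\<And>z r. Im z \<ge> height (norm \<kappa>) n \<Longrightarrow> norm z \<le> r \<Longrightarrow>
       0 < ln (r + norm \<kappa>) + B \<and> norm (inv_branch \<kappa> k n z) \<le> ln (ln (r + norm \<kappa>) + B) + B"
    "\<And>z i. Im z \<ge> height (norm \<kappa>) n \<Longrightarrow> i \<le> n \<Longrightarrow> norm (inv_branch \<kappa> k i z) \<le> norm z + B"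
proof
  define K where "K = pi + 2 * pi * (\<Sum>j<n. \<bar>real_of_int (k j)\<bar>)"
  have K: "\<forall>j<n. pi + 2 * pi * \<bar>real_of_int (k j)\<bar> \<le> K"
    unfolding K_def by (auto intro!: member_le_sum)
  have "K \<ge> 0" unfolding K_def by (simp add: sum_nonneg)
  define B where "B = n * (norm \<kappa> + K) + K + norm \<kappa>"
  show "B \<ge> 0" using \<open>K \<ge> 0\<close> by (simp add: B_def)
  have B_ge: "B \<ge> m * (norm \<kappa> + K) + K + norm \<kappa>" if "m \<le> n" for m
    unfolding B_def using that \<open>K \<ge> 0\<close> by (intro add_right_mono mult_right_mono) auto
  have "K + norm \<kappa> \<le> B" using B_ge[of 0] by simp
  then have "K \<le> B" using norm_ge_zero[of \<kappa>] by linarith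
  show "0 < ln (r + norm \<kappa>) + B \<and> norm (inv_branch \<kappa> k n z) \<le> ln (ln (r + norm \<kappa>) + B) + B"
    if z: "Im z \<ge> height (norm \<kappa>) n" and r: "norm z \<le> r" for z r
  proof -
    define m where "m = n - 2"
    have m: "n = Suc (Suc m)" using \<open>2 \<le> n\<close> by (simp add: m_def)
    let ?w = "inv_branch \<kappa> k (1 + m) z"
    have pos: "0 < norm (inv_branch \<kappa> k i z) + norm \<kappa>" if "i \<le> n" for i
      using inv_branch_norm_ge[OF z that, of k] norm_triangle_ineq4[of "inv_branch \<kappa> k i z" \<kappa>] by simp
    have "norm ?w \<le> norm (inv_branch \<kappa> k 1 z) + m * (norm \<kappa> + K)"
      using m by (intro norm_inv_branch_le[OF z _ K]) auto
    also have "norm (inv_branch \<kappa> k 1 z) \<le> ln (norm z + norm \<kappa>) + K"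
      using norm_inv_branch_Suc[OF z _ K, of 0] m by simp
    also have "ln (norm z + norm \<kappa>) \<le> ln (r + norm \<kappa>)"
      using pos[of 0] r by simp
    finally have w: "norm ?w + norm \<kappa> \<le> ln (r + norm \<kappa>) + B"
      using B_ge[of m] m by simp
    have w0: "0 < norm ?w + norm \<kappa>" using pos[of "1 + m"] m by (simp del: inv_branch.simps(2))
    have "norm (inv_branch \<kappa> k n z) \<le> ln (norm ?w + norm \<kappa>) + K"
      using norm_inv_branch_Suc[OF z _ K, of "1 + m"] m by (simp del: inv_branch.simps(2))
    also have "ln (norm ?w + norm \<kappa>) \<le> ln (ln (r + norm \<kappa>) + B)" using w w0 by (simp del: inv_branch.simps(2))
    finally show ?thesis using w w0 \<open>K \<le> B\<close> by (simp del: inv_branch.simps(2))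
  qed
  show "norm (inv_branch \<kappa> k i z) \<le> norm z + B"
    if z: "Im z \<ge> height (norm \<kappa>) n" and i: "i \<le> n" for z i
  proof -
    have "i * (norm \<kappa> + K) \<le> B"
      using B_ge[OF i] \<open>K \<ge> 0\<close> norm_ge_zero[of \<kappa>] by linarith
    then show ?thesis using norm_inv_branch_le[OF z _ K, of 0 i] i by simp
  qed
qed

section \<open>A half plane in the basin and the choice of branches\<close>

context exp_backward_invariant
begin

text \<open>A far left half plane is mapped into a disc around \<kappa> inside \<open>F\<close>, so
  it lies in \<open>F\<close>. It meets the component of \<open>p\<close> in a lift of a point of
  the punctured disc.\<close>

lemma half_plane_in_basin:
  assumes "connected_component F (exp_map \<kappa> p) \<kappa>"
  obtains b where "\<And>z. Re z < b \<Longrightarrow> connected_component F p z"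
proof -
  have "\<kappa> \<in> F" using connected_component_in[OF assms] by blast
  then obtain d where d: "d > 0" "ball \<kappa> d \<subseteq> F" using open_F open_contains_ball by blast
  have "connected_component F \<kappa> (\<kappa> + of_real (d / 2))"
    unfolding connected_component_def using d
    by (intro exI[of _ "ball \<kappa> d"]) (auto simp: dist_norm simp flip: of_real_divide)
  then have "connected_component F (exp_map \<kappa> p) (\<kappa> + of_real (d / 2))"
    using assms connected_component_trans by blast
  then obtain a where a: "connected_component F p a" "exp_map \<kappa> a = \<kappa> + of_real (d / 2)"
    using connected_component_lift d(1) by (metis add_cancel_left_right half_gt_zero of_real_eq_0_iff order_less_irrefl)
  have "exp (Re a) = d / 2"
    using a(2) d(1) unfolding norm_exp_eq_Re[symmetric] exp_map_def
    by (simp add: algebra_simps del: of_real_divide)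
  then have "Re a < ln d" using d(1) by (metis exp_less_cancel_iff exp_ln field_sum_of_halves less_add_same_cancel1 half_gt_zero)
  show ?thesis
  proof (rule that[of "ln d"])
    fix z assume z: "Re z < ln d"
    have sub: "{z. Re z < ln d} \<subseteq> F"
    proof clarify
      fix z assume "Re z < ln d"
      then have "exp (Re z) < d" using d(1) by (metis exp_less_cancel_iff exp_ln)
      then have "exp_map \<kappa> z \<in> ball \<kappa> d" by (simp add: exp_map_def dist_norm)
      then show "z \<in> F" using d(2) backward[of z] by blast
    qed
    have "connected_component F a z"
      unfolding connected_component_def using sub z \<open>Re a < ln d\<close> convex_connected[OF convex_halfspace_Re_lt] by blast
    then show "connected_component F p z" using a(1) connected_component_trans by blast
  qed
qed

text \<open>The branches are chosen one at a time: the current image of \<open>h\<close> is far from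
  \<kappa>, so it lifts into the preceding component of the cycle, and the lift differs from the
  principal logarithm by a multiple of the period. That multiple becomes \<open>k m\<close>.\<close>

lemma inv_branch_base:
  assumes per: "(exp_map \<kappa> ^^ n) p = p" and n: "n > 0"
    and h: "connected_component F p h" "Im h \<ge> height (norm \<kappa>) n"
  shows "m \<le> n \<Longrightarrow> \<exists>k. \<forall>i\<le>m. connected_component F ((exp_map \<kappa> ^^ (i * (n - 1))) p) (inv_branch \<kappa> k i h)"
proof (induction m)
  case 0
  then show ?case using h by simp
next
  case (Suc m)
  let ?E = "exp_map \<kappa>"
  let ?p = "\<lambda>i. (?E ^^ (i * (n - 1))) p"
  from Suc obtain k where k: "\<And>i. i \<le> m \<Longrightarrow> connected_component F (?p i) (inv_branch \<kappa> k i h)" by auto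
  have "?E (?p (Suc m)) = (?E ^^ (m * (n - 1) + n)) p"
    using n by (cases n) (simp_all add: algebra_simps)
  then have "?E (?p (Suc m)) = ?p m" by (simp add: funpow_add per)
  moreover have far: "norm (inv_branch \<kappa> k m h - \<kappa>) \<ge> 2"
    using Suc.prems by (intro inv_branch_norm_ge[OF h(2)]) auto
  ultimately obtain a where a: "connected_component F (?p (Suc m)) a" "?E a = inv_branch \<kappa> k m h"
    using connected_component_lift[of "?p (Suc m)" "inv_branch \<kappa> k m h"] k[of m] by force
  have "?E (Ln (inv_branch \<kappa> k m h - \<kappa>)) = inv_branch \<kappa> k m h"
    using far by (subst exp_map_def, subst exp_Ln) auto
  with a(2) obtain j :: int where j: "a = Ln (inv_branch \<kappa> k m h - \<kappa>) + of_int j * (2 * of_real pi * \<i>)"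
    using exp_map_eqE by metis
  define k' where "k' = k(m := j)"
  have same: "inv_branch \<kappa> k' i h = inv_branch \<kappa> k i h" if "i \<le> m" for i
    using that by (intro inv_branch_cong) (auto simp: k'_def)
  have "inv_branch \<kappa> k' (Suc m) h = a" by (simp add: same j) (simp add: k'_def)
  then have "\<forall>i\<le>Suc m. connected_component F (?p i) (inv_branch \<kappa> k' i h)"
    using k a(1) same by (auto simp: le_Suc_eq)
  then show ?case by blast
qed

end

section \<open>Pulling back along the cycle\<close>

text \<open>Here \<open>p\<close> is the cycle point whose component contains the left half plane.
  The base point \<open>h\<close> is in this half plane and so high that all \<open>n\<close>
  logarithms are defined, and \<open>k\<close> sends it backwards through the components.\<close>

locale exp_basin = exp_backward_invariant +
  fixes n :: nat and p h :: complex and b :: real and k :: "nat \<Rightarrow> int"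
  assumes n: "2 \<le> n" and per: "(exp_map \<kappa> ^^ n) p = p"
    and half_plane: "Re z < b \<Longrightarrow> connected_component F p z"
    and h: "Re h < b" "height (norm \<kappa>) n \<le> Im h"
    and base: "i \<le> n \<Longrightarrow> connected_component F ((exp_map \<kappa> ^^ (i * (n - 1))) p) (inv_branch \<kappa> k i h)"
begin

abbreviation "E \<equiv> exp_map \<kappa>"
abbreviation "G \<equiv> inv_branch \<kappa> k"
text \<open>
  \<open>E\<^sup>i\<^sup>(\<^sup>n\<^sup>-\<^sup>1\<^sup>) p\<close> is the \<open>i\<close>-th preimage of \<open>p\<close> on its cycle, so \<open>i\<close> counts backwards.
\<close>
abbreviation "basin i \<equiv> connected_component_set F ((E ^^ (i * (n - 1))) p)"
abbreviation "Q \<equiv> {z. height (norm \<kappa>) n \<le> Im z}"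

text \<open>
  The set \<open>\<Gamma>\<close> certifies that its points are joined to \<open>h\<close> inside the domain of \<open>G\<close>; this is what forces
  \<open>G i\<close> to map them into the right Fatou component.
\<close>
definition good :: "real \<Rightarrow> complex set \<Rightarrow> bool" where
  "good r \<Gamma> \<longleftrightarrow> connected \<Gamma> \<and> h \<in> \<Gamma> \<and> \<Gamma> \<subseteq> basin 0 \<inter> Q \<inter> cball 0 r"

lemma good_mono: "good r \<Gamma> \<Longrightarrow> r \<le> s \<Longrightarrow> good s \<Gamma>"
  by (auto simp: good_def subset_iff)

lemma basin_n: "basin n = basin 0"
proof -
  have "(E ^^ (n * m)) p = p" for m
    by (induction m) (simp_all add: funpow_add per)
  then show ?thesis by simp
qed

lemma good_image:
  assumes "good r \<Gamma>" "w \<in> \<Gamma>" "i \<le> n"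
  shows "G i w \<in> basin i"
proof -
  have \<Gamma>: "connected \<Gamma>" "h \<in> \<Gamma>" "\<Gamma> \<subseteq> Q" "\<Gamma> \<subseteq> F"
    using assms(1) connected_component_subset unfolding good_def by blast+
  have "connected_component F (G i h) (G i w)"
  proof (rule connected_component_image[OF \<Gamma>(1) _ _ \<Gamma>(2) assms(2)])
    show "continuous_on \<Gamma> (G i)"
      using inv_branch_continuous[OF assms(3)] \<Gamma>(3) continuous_on_subset by blast
    show "(E ^^ i) (G i z) \<in> F" if "z \<in> \<Gamma>" for z
      using exp_map_funpow_inv_branch[of \<kappa> n z 0 i k] assms(3) that \<Gamma>(3,4) by force
  qed
  then show ?thesis using base[OF assms(3)] connected_component_trans by fastforce
qed

lemma good_segment:
  assumes "j \<ge> (0::int)"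
  shows "good (norm h + 2 * pi * j) (closed_segment h (h + of_int j * (2 * of_real pi * \<i>)))"
proof -
  let ?s = "of_int j * (2 * of_real pi * \<i>)"
  have "z \<in> basin 0 \<inter> Q \<inter> cball 0 (norm h + 2 * pi * j)" if z: "z \<in> closed_segment h (h + ?s)" for z
  proof -
    obtain u where u: "0 \<le> u" "u \<le> 1" "z = (1 - u) *\<^sub>R h + u *\<^sub>R (h + ?s)"
      using z unfolding closed_segment_def by auto
    have z_eq: "z = h + u *\<^sub>R ?s" unfolding u(3) by (simp add: algebra_simps)
    have "norm z \<le> norm h + norm (u *\<^sub>R ?s)" unfolding z_eq by (rule norm_triangle_ineq)
    also have "norm (u *\<^sub>R ?s) = u * (2 * pi * j)" using u assms by (simp add: norm_mult)
    also have "\<dots> \<le> 1 * (2 * pi * j)" using u assms by (intro mult_right_mono) auto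
    finally have "norm z \<le> norm h + 2 * pi * j" by simp
    moreover have "Re z = Re h" by (simp add: z_eq)
    moreover have "Im h \<le> Im z" unfolding z_eq using u(1) assms by simp
    ultimately show ?thesis using h half_plane[of z] by simp
  qed
  then show ?thesis unfolding good_def by auto
qed

text \<open>The set \<open>G n\<close> of \<Gamma> is small, but may leave \<open>Q\<close> and miss
  \<open>h\<close>. It is joined to a fixed path from \<open>h\<close> to \<open>G n h\<close>,
  lifted into \<open>Q\<close> by a multiple of the period, and tied back to \<open>h\<close> by a
  vertical segment. The shift is about as long as the radius, whence the factor 2.\<close>

lemma pull_back_good:
  obtains B where "B \<ge> 0"
    "\<And>r \<Gamma> w. good r \<Gamma> \<Longrightarrow> w \<in> \<Gamma> \<Longrightarrow> \<exists>\<Gamma>' w'. good (2 * (ln (ln (r + norm \<kappa>) + B) + B) + B) \<Gamma>' \<and> w' \<in> \<Gamma>' \<and>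
       (\<forall>i<n. (E ^^ (n - i)) w' = G i w)"
proof -
  obtain B\<^sub>0 where B\<^sub>0: "B\<^sub>0 \<ge> 0"
    "\<And>z r. z \<in> Q \<Longrightarrow> norm z \<le> r \<Longrightarrow> 0 < ln (r + norm \<kappa>) + B\<^sub>0 \<and> norm (G n z) \<le> ln (ln (r + norm \<kappa>) + B\<^sub>0) + B\<^sub>0"
    using norm_inv_branch_loglog[OF n, of \<kappa> k] by (metis mem_Collect_eq)
  have "path_connected (basin 0)"
    using open_F by (intro connected_open_path_connected open_connected_component) auto
  moreover have "h \<in> basin 0" using half_plane[OF h(1)] by simp
  moreover have "G n h \<in> basin 0" using base[of n] unfolding basin_n[symmetric] by simp
  ultimately obtain \<gamma> where \<gamma>: "path \<gamma>" "path_image \<gamma> \<subseteq> basin 0" "pathstart \<gamma> = h" "pathfinish \<gamma> = G n h"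
    unfolding path_connected_def by blast
  let ?S = "path_image \<gamma>"
  have S: "connected ?S" "h \<in> ?S" "G n h \<in> ?S"
    using \<gamma> connected_path_image pathstart_in_path_image pathfinish_in_path_image by metis+
  obtain s where s: "\<And>z. z \<in> ?S \<Longrightarrow> norm z \<le> s"
    using \<gamma>(1) compact_path_image compact_imp_bounded bounded_iff by metis
  have "s \<ge> 0" using s[OF S(2)] norm_ge_zero order_trans by blast
  define l where "l = height (norm \<kappa>) n"
  have "l \<ge> 0" using height_ge[of "norm \<kappa>" n] norm_ge_zero[of \<kappa>] unfolding l_def by linarith
  define B where "B = B\<^sub>0 + s + l + 2 * pi + norm h"
  show ?thesis
  proof (rule that[of B])
    show "B \<ge> 0" using \<open>s \<ge> 0\<close> \<open>l \<ge> 0\<close> B\<^sub>0(1) by (simp add: B_def)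
    fix r \<Gamma> w assume good: "good r \<Gamma>" and w: "w \<in> \<Gamma>"
    have \<Gamma>: "connected \<Gamma>" "h \<in> \<Gamma>" "\<Gamma> \<subseteq> Q" "\<And>z. z \<in> \<Gamma> \<Longrightarrow> norm z \<le> r"
      using good unfolding good_def by auto
    define \<rho> where "\<rho> = ln (ln (r + norm \<kappa>) + B\<^sub>0) + B\<^sub>0 + s"
    have G_le: "0 < ln (r + norm \<kappa>) + B\<^sub>0" "norm (G n z) \<le> \<rho> - s" if "z \<in> \<Gamma>" for z
      using B\<^sub>0(2)[of z r] \<Gamma> that unfolding \<rho>_def by auto
    have \<rho>: "\<rho> \<ge> s" using G_le(2)[OF w] norm_ge_zero[of "G n w"] by linarith
    define T where "T = G n ` \<Gamma> \<union> ?S"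
    have "connected (G n ` \<Gamma>)"
      using \<Gamma> inv_branch_continuous[of n n \<kappa> k] continuous_on_subset
      by (intro connected_continuous_image) auto
    then have "connected T"
      unfolding T_def using S \<Gamma>(2) by (intro connected_Un) auto
    have "G n ` \<Gamma> \<subseteq> basin 0" using good_image[OF good, of _ n] basin_n by auto
    then have "T \<subseteq> basin 0" using \<gamma>(2) by (simp add: T_def)
    then have "T \<subseteq> F" using connected_component_subset by blast
    have T_norm: "norm z \<le> \<rho>" if "z \<in> T" for z
      using that G_le(2) s \<rho> \<open>s \<ge> 0\<close> by (force simp: T_def)
    \<comment> \<open>Enough periods to lift every point of the disc of radius \<rho> above the
      height \<open>l\<close>, overshooting by at most one period.\<close>
    define j where "j = \<lceil>(l + \<rho>) / (2 * pi)\<rceil>"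
    have "(l + \<rho>) / (2 * pi) \<le> j" "j \<le> (l + \<rho>) / (2 * pi) + 1"
      unfolding j_def by linarith+
    then have j: "l + \<rho> \<le> 2 * pi * j" "2 * pi * j \<le> l + \<rho> + 2 * pi"
      by (simp_all add: field_simps)
    have "0 \<le> 2 * pi * j" using j(1) \<rho> \<open>s \<ge> 0\<close> \<open>l \<ge> 0\<close> by linarith
    then have "j \<ge> 0" using mult_pos_neg[of "2 * pi" "real_of_int j"] by force
    let ?s = "of_int j * (2 * of_real pi * \<i>)"
    have norm_s: "norm ?s = 2 * pi * j" using \<open>j \<ge> 0\<close> by (simp add: norm_mult)
    define \<Gamma>' where "\<Gamma>' = (\<lambda>z. z + ?s) ` T \<union> closed_segment h (h + ?s)"
    let ?R = "2 * (ln (ln (r + norm \<kappa>) + B) + B) + B"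
    have "ln (ln (r + norm \<kappa>) + B\<^sub>0) \<le> ln (ln (r + norm \<kappa>) + B)"
      using G_le(1)[OF w] \<open>s \<ge> 0\<close> \<open>l \<ge> 0\<close> by (intro ln_mono) (auto simp: B_def)
    then have "\<rho> - B\<^sub>0 - s \<le> ln (ln (r + norm \<kappa>) + B)" by (simp add: \<rho>_def)
    then have R: "2 * \<rho> + l + 2 * pi + norm h \<le> ?R"
      using B_def \<open>s \<ge> 0\<close> \<open>l \<ge> 0\<close> B\<^sub>0(1) norm_ge_zero[of h] pi_ge_zero by argo
    have segment: "good ?R (closed_segment h (h + ?s))"
      using R j(2) \<rho> \<open>s \<ge> 0\<close> by (intro good_mono[OF good_segment[OF \<open>j \<ge> 0\<close>]]) linarith
    have conn: "connected ((\<lambda>z. z + ?s) ` T)"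
      using \<open>connected T\<close> by (intro connected_continuous_image continuous_intros)
    have hs: "h + ?s \<in> (\<lambda>z. z + ?s) ` T" using S(2) by (auto simp: T_def)
    have "(\<lambda>z. z + ?s) ` T \<subseteq> F" using \<open>T \<subseteq> F\<close> translate by blast
    from connected_component_maximal[OF hs conn this]
    have "(\<lambda>z. z + ?s) ` T \<subseteq> connected_component_set F (h + ?s)" .
    \<comment> \<open>The segment from \<open>h\<close> to \<open>h + ?s\<close> lies in the half
      plane, so the translated set is in \<open>basin 0\<close> and in no other component.\<close>
    moreover have "connected_component_set F (h + ?s) = basin 0"
      using segment by (intro connected_component_eq) (auto simp: good_def)
    ultimately have "(\<lambda>z. z + ?s) ` T \<subseteq> basin 0" by simp
    moreover have "z + ?s \<in> Q \<inter> cball 0 ?R" if z: "z \<in> T" for z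
    proof -
      have "Im (z + ?s) \<ge> - norm z + 2 * pi * j"
        using abs_Im_le_cmod[of z] by simp
      then have "z + ?s \<in> Q" using T_norm[OF z] j(1) unfolding l_def by (simp add: mult_ac)
      moreover have "norm (z + ?s) \<le> ?R"
        using norm_triangle_ineq[of z ?s] norm_s T_norm[OF z] j(2) R norm_ge_zero[of h] by argo
      ultimately show ?thesis by simp
    qed
    ultimately have "good ?R \<Gamma>'"
      unfolding good_def \<Gamma>'_def
      using segment conn hs unfolding good_def
      by (intro conjI connected_Un) (auto intro!: exI[of _ "h + ?s"])
    moreover have "G n w + ?s \<in> \<Gamma>'" using w by (auto simp: \<Gamma>'_def T_def)
    \<comment> \<open>For \<open>i < n\<close> at least one application of \<open>E\<close> is made,
      and it forgets the translation.\<close>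
    moreover have "(E ^^ (n - i)) (G n w + ?s) = G i w" if "i < n" for i
    proof -
      obtain m where m: "n - i = Suc m" using \<open>i < n\<close> by (metis Suc_diff_Suc)
      have "(E ^^ (n - i)) (G n w + ?s) = (E ^^ (n - i)) (G n w)"
        unfolding m by (simp only: funpow_Suc_right o_apply exp_map_add_period)
      also have "\<dots> = G i w"
        using exp_map_funpow_inv_branch[of \<kappa> n w i "n - i" k] \<open>i < n\<close> \<Gamma>(3) w by auto
      finally show ?thesis .
    qed
    ultimately show "\<exists>\<Gamma>' w'. good ?R \<Gamma>' \<and> w' \<in> \<Gamma>' \<and> (\<forall>i<n. (E ^^ (n - i)) w' = G i w)" by blast
  qed
qed

end

text \<open>With \<open>s \<mapsto> exp s + d\<close> as tower step, one pullback of a set of radius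
  three times a tower undoes two steps. The double logarithm is at most \<open>t + 1\<close>, so the
  bound is \<open>2 * t\<close> plus a constant, which the factor 3 absorbs for large
  \<open>t\<close>.\<close>

lemma tower_growth:
  fixes c d B :: real
  assumes "c \<ge> 0" "d \<ge> 0" "B \<ge> 0"
    and t: "t \<ge> 3 * B + 3 * d + c + 2"
  shows "2 * (ln (ln (3 * (exp (exp t + d) + d) + c) + B) + B) + B \<le> 3 * t"
proof -
  define x where "x = exp t + d"
  have exp_t: "t + 1 \<le> exp t" and exp_x: "x + 1 \<le> exp x" and exp_1: "2 \<le> exp (1::real)"
    using exp_ge_add_one_self[of t] exp_ge_add_one_self[of x] exp_ge_add_one_self[of 1] by argo+
  have "2 * 2 \<le> exp 1 * exp (1::real)" using exp_1 by (intro mult_mono) auto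
  then have exp_2: "4 \<le> exp (2::real)" by (simp flip: exp_add)
  define y where "y = 3 * (exp x + d) + c"
  have "y \<le> exp x * 4" using exp_x exp_t t assms unfolding x_def y_def by argo
  also have "\<dots> \<le> exp x * exp 2" using exp_2 by simp
  finally have y: "y \<le> exp (x + 2)" by (simp add: exp_add)
  have y1: "1 < y" using exp_x exp_t t assms unfolding x_def y_def by argo
  have "ln y \<le> x + 2" using y y1 by (metis exp_gt_zero ln_exp ln_le_cancel_iff order_less_trans zero_less_one)
  then have "ln y + B \<le> 2 * exp t" using exp_t t assms unfolding x_def by argo
  also have "\<dots> \<le> exp (t + 1)" using exp_1 by (simp add: exp_add)
  finally have "ln y + B \<le> exp (t + 1)" .
  moreover have "0 < ln y + B" using y1 \<open>B \<ge> 0\<close> by (simp add: add_pos_nonneg)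
  ultimately have "ln (ln y + B) \<le> t + 1" by (metis exp_gt_zero ln_exp ln_le_cancel_iff)
  then have "2 * (ln (ln y + B) + B) + B \<le> 3 * t" using t assms by argo
  then show ?thesis unfolding y_def x_def .
qed

section \<open>Growth of the conjugacy\<close>

context exp_basin
begin

text \<open>Each pullback lowers the radius by two applications of \<open>A\<close>, while the
  conjugacy equation costs only one application in the bound for \<Psi>. This mismatch drives the
  contradiction.\<close>

lemma conjugacy_pull_back:
  fixes \<Psi> :: "complex \<Rightarrow> complex"
  assumes "i < n" and conj: "\<And>z. z \<in> basin i \<Longrightarrow> \<Psi> ((E ^^ n) z) = exp_map \<kappa>' (\<Psi> z)"
    and B: "\<And>r \<Gamma> w. good r \<Gamma> \<Longrightarrow> w \<in> \<Gamma> \<Longrightarrow> \<exists>\<Gamma>' w'. good (2 * (ln (ln (r + norm \<kappa>) + B) + B) + B) \<Gamma>' \<and> w' \<in> \<Gamma>' \<and>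
       (\<forall>i<n. (E ^^ (n - i)) w' = G i w)"
    and A_def: "A = (\<lambda>t. exp t + norm \<kappa>')"
    and t\<^sub>0: "\<And>t. t \<ge> t\<^sub>0 \<Longrightarrow> 2 * (ln (ln (3 * A (A t) + norm \<kappa>) + B) + B) + B \<le> 3 * t"
  shows "good (3 * (A ^^ (2 * m)) t\<^sub>0) \<Gamma> \<Longrightarrow> w \<in> \<Gamma> \<Longrightarrow>
    \<exists>\<Gamma>' w'. good (3 * t\<^sub>0) \<Gamma>' \<and> w' \<in> \<Gamma>' \<and> norm (\<Psi> (G i w)) \<le> (A ^^ m) (norm (\<Psi> (G i w')))"
proof (induction m arbitrary: \<Gamma> w)
  case 0
  then show ?case by auto
next
  case (Suc m)
  have A_ge: "t \<le> A t" for t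
    using exp_ge_add_one_self[of t] norm_ge_zero[of \<kappa>'] unfolding A_def by linarith
  define t where "t = (A ^^ (2 * m)) t\<^sub>0"
  have "t\<^sub>0 \<le> (A ^^ j) t\<^sub>0" for j
    by (induction j) (auto intro: order_trans A_ge)
  then have t: "t\<^sub>0 \<le> t" by (simp add: t_def)
  have "good (3 * A (A t)) \<Gamma>" using Suc.prems(1) by (simp add: t_def)
  from B[OF this Suc.prems(2)] obtain \<Gamma>\<^sub>1 w\<^sub>1 where w\<^sub>1:
    "good (2 * (ln (ln (3 * A (A t) + norm \<kappa>) + B) + B) + B) \<Gamma>\<^sub>1" "w\<^sub>1 \<in> \<Gamma>\<^sub>1" "(E ^^ (n - i)) w\<^sub>1 = G i w"
    using \<open>i < n\<close> by blast
  have good: "good (3 * t) \<Gamma>\<^sub>1" using good_mono[OF w\<^sub>1(1) t\<^sub>0[OF t]] .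
  then obtain \<Gamma>' w' where w': "good (3 * t\<^sub>0) \<Gamma>'" "w' \<in> \<Gamma>'" "norm (\<Psi> (G i w\<^sub>1)) \<le> (A ^^ m) (norm (\<Psi> (G i w')))"
    using Suc.IH w\<^sub>1(2) unfolding t_def by blast
  have "w\<^sub>1 \<in> Q" using good w\<^sub>1(2) unfolding good_def by blast
  then have "(E ^^ i) (G i w\<^sub>1) = w\<^sub>1"
    using exp_map_funpow_inv_branch[of \<kappa> n w\<^sub>1 0 i k] \<open>i < n\<close> by simp
  then have "(E ^^ (n - i + i)) (G i w\<^sub>1) = G i w" using w\<^sub>1(3) by (simp only: funpow_add o_apply)
  then have "(E ^^ n) (G i w\<^sub>1) = G i w" using \<open>i < n\<close> by simp
  then have "\<Psi> (G i w) = exp_map \<kappa>' (\<Psi> (G i w\<^sub>1))"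
    using conj[OF good_image[OF good w\<^sub>1(2), of i]] \<open>i < n\<close> by simp
  then have "norm (\<Psi> (G i w)) \<le> A (norm (\<Psi> (G i w\<^sub>1)))"
    using norm_exp_map_le by (simp add: A_def)
  also have "\<dots> \<le> A ((A ^^ m) (norm (\<Psi> (G i w'))))" using w'(3) by (simp add: A_def)
  finally show ?case using w'(1,2) by auto
qed

text \<open>The translates of \<open>h\<close> have images under \<open>G i\<close> with a common
  value of \<open>E ^^ n\<close>, so by the conjugacy their \<Psi>-values differ by multiples of the
  period. Injectivity makes these multiples distinct.\<close>

lemma conjugacy_large_values:
  fixes \<Psi> :: "complex \<Rightarrow> complex"
  assumes "i < n" and conj: "\<And>z. z \<in> basin i \<Longrightarrow> \<Psi> ((E ^^ n) z) = exp_map \<kappa>' (\<Psi> z)"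
    and inj: "inj_on \<Psi> (basin i)"
  obtains j where "j \<le> m" "norm (\<Psi> (G i (h + of_int (int j) * (2 * of_real pi * \<i>)))) \<ge> pi * real m - norm (\<Psi> (G i h))"
proof -
  let ?s = "\<lambda>j::nat. of_int (int j) * (2 * of_real pi * \<i>) :: complex"
  let ?f = "\<lambda>j. \<Psi> (G i (h + ?s j))"
  have segment: "good (norm h + 2 * pi * int j) (closed_segment h (h + ?s j))" for j
    by (rule good_segment) simp
  have in_basin: "G i (h + ?s j) \<in> basin i" for j
    using good_image[OF segment, of "h + ?s j" j i] \<open>i < n\<close> by simp
  have EG: "(E ^^ i) (G i (h + ?s j)) = h + ?s j" for j
  proof -
    have "h + ?s j \<in> Q" using segment[of j] unfolding good_def by auto
    then show ?thesis
      using exp_map_funpow_inv_branch[of \<kappa> n "h + ?s j" 0 i k] \<open>i < n\<close> by simp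
  qed
  have En: "(E ^^ n) (G i (h + ?s j)) = (E ^^ (n - i)) h" for j
  proof -
    obtain l where l: "n - i = Suc l" using \<open>i < n\<close> by (metis Suc_diff_Suc)
    have "(E ^^ n) (G i (h + ?s j)) = (E ^^ (n - i + i)) (G i (h + ?s j))" using \<open>i < n\<close> by simp
    also have "\<dots> = (E ^^ (n - i)) (h + ?s j)" by (simp only: funpow_add o_apply EG)
    also have "\<dots> = (E ^^ (n - i)) h" unfolding l by (simp only: funpow_Suc_right o_apply exp_map_add_period)
    finally show ?thesis .
  qed
  have "\<exists>N::int. ?f j = \<Psi> (G i h) + of_int N * (2 * of_real pi * \<i>)" for j
  proof -
    have "exp_map \<kappa>' (?f j) = exp_map \<kappa>' (?f 0)"
      by (simp only: conj[OF in_basin, symmetric] En)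
    then obtain N :: int where "?f j = ?f 0 + of_int N * (2 * of_real pi * \<i>)"
      by (rule exp_map_eqE)
    then show ?thesis by auto
  qed
  then obtain N :: "nat \<Rightarrow> int" where N: "\<And>j. ?f j = \<Psi> (G i h) + of_int (N j) * (2 * of_real pi * \<i>)"
    by metis
  have "inj N"
  proof (rule injI)
    fix x y assume "N x = N y"
    then have "?f x = ?f y" using N by simp
    then have "G i (h + ?s x) = G i (h + ?s y)" using inj in_basin by (meson inj_onD)
    then have "h + ?s x = h + ?s y" using EG by metis
    then show "x = y" by simp
  qed
  \<comment> \<open>Pigeonhole: at most \<open>m\<close> integers have absolute value below
    \<open>m / 2\<close>, but \<open>m + 1\<close> distinct ones occur.\<close>
  have "\<exists>j\<le>m. int m \<le> 2 * \<bar>N j\<bar>"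
  proof (rule ccontr)
    assume "\<not> ?thesis"
    then have "N ` {..m} \<subseteq> {j. 2 * \<bar>j\<bar> < int m}" by auto
    also have "\<dots> \<subseteq> {- ((int m - 1) div 2) .. (int m - 1) div 2}" by auto
    finally have "card (N ` {..m}) \<le> card {- ((int m - 1) div 2) .. (int m - 1) div 2}"
      by (intro card_mono) auto
    moreover have "card (N ` {..m}) = Suc m" using \<open>inj N\<close> by (simp add: card_image inj_on_subset)
    ultimately show False by (simp add: nat_le_iff)
  qed
  then obtain j where j: "j \<le> m" "int m \<le> 2 * \<bar>N j\<bar>" by blast
  have "pi * real m \<le> pi * (2 * \<bar>real_of_int (N j)\<bar>)"
    using j(2) by (intro mult_left_mono) (linarith, simp)
  also have "\<dots> = norm (of_int (N j) * (2 * of_real pi * \<i>))" by (simp add: norm_mult)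
  also have "\<dots> \<le> norm (?f j) + norm (\<Psi> (G i h))"
    using norm_triangle_ineq4[of "?f j" "\<Psi> (G i h)"] N[of j] by simp
  finally show ?thesis using j(1) that by force
qed

text \<open>On points of radius \<open>3 * x\<close> the pullbacks bound \<Psi> by \<open>x\<close>,
  whereas on the vertical segment of that radius \<Psi> reaches about
  \<open>3 * x / 2\<close>.\<close>

lemma conjugacy_unbounded:
  fixes \<Psi> :: "complex \<Rightarrow> complex"
  assumes "i < n" and conj: "\<And>z. z \<in> basin i \<Longrightarrow> \<Psi> ((E ^^ n) z) = exp_map \<kappa>' (\<Psi> z)"
    and inj: "inj_on \<Psi> (basin i)"
  shows "\<exists>R. \<not> bounded (\<Psi> ` (basin i \<inter> cball 0 R))"
proof (rule ccontr)
  assume "\<not> ?thesis"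
  then have bdd: "bounded (\<Psi> ` (basin i \<inter> cball 0 R))" for R by blast
  define A where "A = (\<lambda>t. exp t + norm \<kappa>')"
  have A_ge: "t + 1 \<le> A t" for t
    using exp_ge_add_one_self[of t] norm_ge_zero[of \<kappa>'] unfolding A_def by linarith
  have A_mono: "(A ^^ m) s \<le> (A ^^ m) t" if "s \<le> t" for s t m
    using that by (induction m) (auto simp: A_def)
  have A_pow_ge: "t + real m \<le> (A ^^ m) t" for t m
  proof (induction m)
    case (Suc m)
    then show ?case using A_ge[of "(A ^^ m) t"] by simp
  qed simp
  obtain B where B: "B \<ge> 0"
    "\<And>r \<Gamma> w. good r \<Gamma> \<Longrightarrow> w \<in> \<Gamma> \<Longrightarrow> \<exists>\<Gamma>' w'. good (2 * (ln (ln (r + norm \<kappa>) + B) + B) + B) \<Gamma>' \<and> w' \<in> \<Gamma>' \<and>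
       (\<forall>i<n. (E ^^ (n - i)) w' = G i w)"
    using pull_back_good by blast
  define t\<^sub>0 where "t\<^sub>0 = 3 * B + 3 * norm \<kappa>' + norm \<kappa> + 2"
  have t\<^sub>0: "2 * (ln (ln (3 * A (A t) + norm \<kappa>) + B) + B) + B \<le> 3 * t" if "t \<ge> t\<^sub>0" for t
    using tower_growth[OF norm_ge_zero norm_ge_zero B(1)] that unfolding A_def t\<^sub>0_def by blast
  obtain B' where B': "\<And>z. z \<in> Q \<Longrightarrow> norm (G i z) \<le> norm z + B'"
    using norm_inv_branch_loglog[OF n, of \<kappa> k] \<open>i < n\<close> by (metis mem_Collect_eq less_imp_le)
  obtain M where M: "\<And>z. z \<in> basin i \<Longrightarrow> norm z \<le> 3 * t\<^sub>0 + B' \<Longrightarrow> norm (\<Psi> z) \<le> M"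
    using bdd[of "3 * t\<^sub>0 + B'"] unfolding bounded_iff by (auto simp: image_iff) (metis IntI mem_Collect_eq mem_cball_0)
  have upper: "norm (\<Psi> (G i w)) \<le> (A ^^ m) M" if \<Gamma>: "good (3 * (A ^^ (2 * m)) t\<^sub>0) \<Gamma>" "w \<in> \<Gamma>" for m \<Gamma> w
  proof -
    have "\<exists>\<Gamma>' w'. good (3 * t\<^sub>0) \<Gamma>' \<and> w' \<in> \<Gamma>' \<and> norm (\<Psi> (G i w)) \<le> (A ^^ m) (norm (\<Psi> (G i w')))"
      by (rule conjugacy_pull_back[OF \<open>i < n\<close> _ _ A_def _ \<Gamma>]) (fact conj B(2) t\<^sub>0)+
    then obtain \<Gamma>' w' where w': "good (3 * t\<^sub>0) \<Gamma>'" "w' \<in> \<Gamma>'" "norm (\<Psi> (G i w)) \<le> (A ^^ m) (norm (\<Psi> (G i w')))"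
      by blast
    have "w' \<in> Q" "norm w' \<le> 3 * t\<^sub>0" using w'(1,2) unfolding good_def by auto
    then have "norm (G i w') \<le> 3 * t\<^sub>0 + B'" using B'[of w'] by simp
    then have "norm (\<Psi> (G i w')) \<le> M"
      using M good_image[OF w'(1,2)] \<open>i < n\<close> by simp
    then show ?thesis using w'(3) A_mono order_trans by blast
  qed
  \<comment> \<open>The final comparison yields \<open>x \<le> C\<close>. The choice of
    \<open>m\<close> makes \<open>x\<close> exceed \<open>C\<close> and also makes \<open>m\<close>
    steps from \<open>t\<^sub>0\<close> pass \<open>M\<close>.\<close>
  define C where "C = norm h + 2 * pi + 2 * norm (\<Psi> (G i h))"
  obtain m :: nat where m: "real m \<ge> \<bar>M\<bar> + \<bar>t\<^sub>0\<bar> + C + 1" using real_arch_simple by blast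
  define x where "x = (A ^^ (2 * m)) t\<^sub>0"
  have x: "x = (A ^^ m) ((A ^^ m) t\<^sub>0)" by (simp add: x_def mult_2 funpow_add)
  have "M \<le> (A ^^ m) t\<^sub>0"
    using A_pow_ge[of t\<^sub>0 m] m norm_ge_zero[of h] pi_ge_zero norm_ge_zero[of "\<Psi> (G i h)"]
    unfolding C_def by linarith
  then have Mx: "(A ^^ m) M \<le> x" unfolding x by (rule A_mono)
  have Cx: "C < x" "norm h \<le> C"
    using A_pow_ge[of t\<^sub>0 "2 * m"] m norm_ge_zero[of h] pi_ge_zero norm_ge_zero[of "\<Psi> (G i h)"]
    unfolding C_def x_def by auto
  \<comment> \<open>The largest number of periods for which the segment from \<open>h\<close> is
    certain to stay within radius \<open>3 * x\<close>.\<close>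
  define q where "q = nat \<lfloor>(3 * x - norm h) / (2 * pi)\<rfloor>"
  have "0 \<le> (3 * x - norm h) / (2 * pi)" using order_trans[OF norm_ge_zero Cx(2)] Cx by (intro divide_nonneg_nonneg) (linarith, simp)
  then have "real q \<le> (3 * x - norm h) / (2 * pi)" "(3 * x - norm h) / (2 * pi) \<le> real q + 1"
    unfolding q_def by linarith+
  then have q: "2 * pi * real q \<le> 3 * x - norm h" "3 * x - norm h \<le> 2 * pi * real q + 2 * pi"
    by (simp_all add: field_simps)
  obtain j where j: "j \<le> q" "norm (\<Psi> (G i (h + of_int (int j) * (2 * of_real pi * \<i>)))) \<ge> pi * real q - norm (\<Psi> (G i h))"
    using conjugacy_large_values[OF \<open>i < n\<close> conj inj] by blast
  have "2 * pi * real j \<le> 2 * pi * real q" using j(1) by simp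
  then have "norm h + 2 * pi * real_of_int (int j) \<le> 3 * x"
    unfolding of_int_of_nat_eq using q(1) by linarith
  then have "good (3 * x) (closed_segment h (h + of_int (int j) * (2 * of_real pi * \<i>)))"
    by (intro good_mono[OF good_segment]) simp_all
  then have "norm (\<Psi> (G i (h + of_int (int j) * (2 * of_real pi * \<i>)))) \<le> (A ^^ m) M"
    unfolding x_def by (rule upper) simp
  then have "pi * real q - norm (\<Psi> (G i h)) \<le> x" using j(2) Mx by linarith
  then show False using q(2) Cx(1) norm_ge_zero[of h] unfolding C_def by simp
qed

end

section \<open>From the basin estimates to the boundary behaviour\<close>

theorem theorem1p3:
  fixes \<kappa> \<kappa>' p q :: complex and n :: nat and U :: "complex set"
    and \<Psi> :: "complex \<Rightarrow> complex"
  assumes "n > 1"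
    and "attracting_periodic_point (exp_map \<kappa>) n p"
    and "attracting_periodic_point (exp_map \<kappa>') 1 q"
    and "multiplier (exp_map \<kappa>') 1 q = multiplier (exp_map \<kappa>) n p"
    and "immediate_basin (exp_map \<kappa>) p U"
    and "conformal_isomorphism \<Psi> U (fatou_set (exp_map \<kappa>'))"
    and "\<And>z. z \<in> U \<Longrightarrow> \<Psi> ((exp_map \<kappa> ^^ n) z) = exp_map \<kappa>' (\<Psi> z)"
  shows "\<not> (\<exists>\<Phi> :: complex \<Rightarrow> complex.
             continuous_on (closure U) \<Phi> \<and> (\<forall>z\<in>U. \<Phi> z = \<Psi> z))"
proof
  assume "\<exists>\<Phi> :: complex \<Rightarrow> complex. continuous_on (closure U) \<Phi> \<and> (\<forall>z\<in>U. \<Phi> z = \<Psi> z)"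
  then obtain \<Phi> :: "complex \<Rightarrow> complex" where \<Phi>: "continuous_on (closure U) \<Phi>" "\<And>z. z \<in> U \<Longrightarrow> \<Phi> z = \<Psi> z"
    by blast
  let ?E = "exp_map \<kappa>"
  define F where "F = fatou_set ?E"
  interpret exp_backward_invariant \<kappa> F
    unfolding F_def by (rule exp_backward_invariant_fatou_set)
  have per: "(?E ^^ n) p = p" and att: "norm (multiplier ?E n p) < 1"
    using assms(2) unfolding attracting_periodic_point_def periodic_point_def by auto
  obtain j where U: "U \<in> components F" "(?E ^^ j) p \<in> U"
    using assms(5) unfolding immediate_basin_def F_def by blast
  have "p \<in> F" using funpow_backward U in_components_subset by blast
  have per_mult: "(?E ^^ (n * m)) p = p" for m
    by (induction m) (simp_all add: funpow_add per)
  have per_mod: "(?E ^^ a) p = (?E ^^ b) p" if "a mod n = b mod n" for a b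
  proof -
    have "(?E ^^ a) p = (?E ^^ (a mod n)) p" for a
      using mod_mult_div_eq[of a n] per_mult[of "a div n"] by (metis comp_apply funpow_add)
    then show ?thesis using that by metis
  qed
  obtain s where s: "connected_component F ((?E ^^ s) p) \<kappa>"
    using asymptotic_value_in_basin[OF _ per att \<open>p \<in> F\<close>] assms(1) by auto
  \<comment> \<open>The predecessor on the cycle of the point whose component contains \<kappa>;
    adding \<open>n\<close> avoids truncated subtraction at \<open>s = 0\<close>.\<close>
  define p\<^sub>0 where "p\<^sub>0 = (?E ^^ (s + n - 1)) p"
  have "?E p\<^sub>0 = (?E ^^ Suc (s + n - 1)) p" by (simp add: p\<^sub>0_def)
  also have "\<dots> = (?E ^^ s) p" using assms(1) by (intro per_mod) simp
  finally have "?E p\<^sub>0 = (?E ^^ s) p" .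
  then obtain b where b: "\<And>z. Re z < b \<Longrightarrow> connected_component F p\<^sub>0 z"
    using half_plane_in_basin[of p\<^sub>0] s by auto
  have per\<^sub>0: "(?E ^^ n) p\<^sub>0 = p\<^sub>0"
    unfolding p\<^sub>0_def using per_mod[of "n + (s + n - 1)" "s + n - 1"] by (simp add: funpow_add)
  define h where "h = Complex (b - 1) (height (norm \<kappa>) n)"
  have h: "Re h < b" "height (norm \<kappa>) n \<le> Im h" by (simp_all add: h_def)
  obtain k where k: "\<And>i. i \<le> n \<Longrightarrow> connected_component F ((?E ^^ (i * (n - 1))) p\<^sub>0) (inv_branch \<kappa> k i h)"
    using inv_branch_base[OF per\<^sub>0 _ b[OF h(1)] h(2), of n] assms(1) by auto
  \<comment> \<open>Since \<open>basin\<close> counts backwards from \<open>p\<^sub>0\<close>, the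
    component \<open>U\<close> at position \<open>j\<close> has index \<open>s - 1 - j\<close>
    modulo \<open>n\<close>, computed next.\<close>
  interpret exp_basin \<kappa> F n p\<^sub>0 h b k
    using assms(1) per\<^sub>0 b h k by unfold_locales auto
  obtain i where i: "i < n" "(i * (n - 1) + (s + n - 1)) mod n = j mod n"
  proof -
    define i where "i = nat ((int s - 1 - int j) mod int n)"
    have i: "int i = (int s - 1 - int j) mod int n" "i < n"
      using assms(1) by (auto simp: i_def nat_less_iff)
    obtain q where q: "int i = int s - 1 - int j - int n * q"
      unfolding i(1) by (metis minus_mult_div_eq_mod)
    obtain l where l: "n = Suc l" using assms(1) by (cases n) auto
    have "int (i * (n - 1) + (s + n - 1)) - int j = int n * (int i + 1 + q)"
      using q by (simp add: l algebra_simps)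
    then have "int (i * (n - 1) + (s + n - 1)) mod int n = int j mod int n"
      by (simp add: mod_eq_dvd_iff)
    then show ?thesis using i(2) that by (metis of_nat_eq_iff of_nat_mod)
  qed
  have "(?E ^^ (i * (n - 1))) p\<^sub>0 = (?E ^^ j) p"
    using per_mod[OF i(2)] unfolding p\<^sub>0_def by (simp only: funpow_add o_apply)
  then have U_eq: "basin i = U"
    using U by (metis components_iff connected_component_eq)
  have "inj_on \<Psi> (basin i)"
    unfolding U_eq using assms(6) by (simp add: conformal_isomorphism_def bij_betw_def)
  then obtain R where R: "\<not> bounded (\<Psi> ` (U \<inter> cball 0 R))"
    using conjugacy_unbounded[of i \<Psi> \<kappa>'] i(1) assms(7) unfolding U_eq by blast
  \<comment> \<open>The bounded part of the closure is compact, so a continuous extension would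
    bound \<Psi> there.\<close>
  have "compact (\<Phi> ` (closure U \<inter> cball 0 R))"
    using \<Phi>(1) by (intro compact_continuous_image closed_Int_compact) (auto intro: continuous_on_subset)
  moreover have "\<Psi> ` (U \<inter> cball 0 R) = \<Phi> ` (U \<inter> cball 0 R)"
    using \<Phi>(2) by (intro image_cong) auto
  moreover have "\<Phi> ` (U \<inter> cball 0 R) \<subseteq> \<Phi> ` (closure U \<inter> cball 0 R)"
    by (intro image_mono Int_mono closure_subset order_refl)
  ultimately show False using R by (metis bounded_subset compact_imp_bounded)
qed

end
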